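(* Let $n$ be a positive integer with binary representation $n = \sum_{k \geq 0} a_k 2^k$ (each $a_k \in \{0,1\}$, all but finitely many zero), and let $\gamma$ be the exponent of the highest power of $2$ dividing $n!$. Then $n! = 2^{\gamma} Z$, where $Z$ is odd and satisfies $$Z \equiv 3^{\alpha_3(n)} (-1)^{\alpha_5(n)} \pmod{8}.$$
   Context: For a positive integer $n = \sum_{k \geq 0} a_k 2^k$ in binary, define $\alpha_3(n) := \#\{ k \geq 0 : \sum_{i=k}^{k+2} a_i 2^{i-k} \in \{3,4\} \}$ and $\alpha_5(n) := \#\{ k \geq 0 : \sum_{i=k}^{k+2} a_i 2^{i-k} \in \{5,6\} \}$, i.e. the number of positions $k$ at which the 3-bit window $(a_{k+2}a_{k+1}a_k)_2$ has value in $\{3,4\}$, respectively $\{5,6\}$. By Legendre's formula, $\gamma = n - \sum_{k\ge 0} a_k$. *)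

theory Defs
  imports "HOL-Number_Theory.Number_Theory"
begin

definition is_binary_rep :: "(nat \<Rightarrow> nat) \<Rightarrow> nat \<Rightarrow> bool" where
  "is_binary_rep a n \<longleftrightarrow>
     (\<forall>k. a k \<in> {0, 1}) \<and> finite {k. a k \<noteq> 0} \<and> n = (\<Sum>k | a k \<noteq> 0. a k * 2 ^ k)"

definition window3 :: "(nat \<Rightarrow> nat) \<Rightarrow> nat \<Rightarrow> nat" where
  "window3 a k = (\<Sum>i = k..k + 2. a i * 2 ^ (i - k))"

text \<open>
  The counting functions below take the digit sequence of a number rather than the number itself.
  For a sequence \<open>a\<close> of finite support, windows of nonzero value start at only finitely many
  positions, so the cardinalities are genuine.
\<close>

definition alpha3 :: "(nat \<Rightarrow> nat) \<Rightarrow> nat" where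
  "alpha3 a = card {k. window3 a k \<in> {3, 4}}"

definition alpha5 :: "(nat \<Rightarrow> nat) \<Rightarrow> nat" where
  "alpha5 a = card {k. window3 a k \<in> {5, 6}}"

end

theory Submission
  imports Defs
begin

text \<open>
  For a prime \<open>p\<close>, collecting the multiples of \<open>p\<close> among \<open>1, \<dots>, n\<close> leaves the product of the
  numbers up to \<open>n\<close> that are coprime to \<open>p\<close>, the Gauss factorial, and contributes
  \<open>p^(n div p) (n div p)!\<close>. Iterating, the \<open>p\<close>-free part of \<open>n!\<close> is the product of the Gauss
  factorials of all \<open>n div p^k\<close>. For \<open>p = 2\<close>, the block \<open>1 * 3 * 5 * 7\<close> is \<open>1\<close> modulo \<open>8\<close>, so the
  Gauss factorial of \<open>n div 2^k\<close> modulo \<open>8\<close> depends only on \<open>n div 2^k mod 8\<close>, which is the value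
  of the window at position \<open>k\<close>: it is \<open>3\<close> for the values \<open>3, 4\<close>, it is \<open>-1\<close> for \<open>5, 6\<close>, and \<open>1\<close>
  otherwise.
\<close>

definition gauss_fact :: "nat \<Rightarrow> nat \<Rightarrow> nat" where
  "gauss_fact m n = \<Prod>{k \<in> {1..n}. coprime k m}"

lemma gauss_fact_0 [simp]: "gauss_fact m 0 = 1"
  by (simp add: gauss_fact_def)

lemma gauss_fact_Suc [simp]:
  "gauss_fact m (Suc n) = (if coprime (Suc n) m then Suc n else 1) * gauss_fact m n"
proof -
  have "{k \<in> {1..Suc n}. coprime k m} =
      (if coprime (Suc n) m then {Suc n} else {}) \<union> {k \<in> {1..n}. coprime k m}"
    by (auto simp: le_Suc_eq)
  then show ?thesis
    by (simp add: gauss_fact_def)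
qed

lemma gauss_fact_numeral [simp]:
  "gauss_fact m (numeral k) =
    (if coprime (numeral k) m then numeral k else 1) * gauss_fact m (pred_numeral k)"
  by (simp only: numeral_eq_Suc gauss_fact_Suc)

lemma coprime_gauss_fact: "coprime (gauss_fact m n) m"
  unfolding gauss_fact_def by (rule prod_coprime_left) simp

lemma coprime_prod_gauss_fact: "coprime (\<Prod>k\<in>A. gauss_fact m (f k)) m"
  by (intro prod_coprime_left coprime_gauss_fact)

lemma gauss_fact_add_cong:
  assumes "d dvd m"
  shows "[gauss_fact d (m + n) = gauss_fact d m * gauss_fact d n] (mod m)"
proof (induction n)
  case 0
  then show ?case by simp
next
  case (Suc n)
  let ?factor = "\<lambda>k. if coprime k d then k else 1"
  have shift: "[Suc (m + n) = Suc n] (mod m)"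
    by (simp only: cong_def mod_add_self1 flip: add_Suc_right)
  then have "coprime (Suc (m + n)) d \<longleftrightarrow> coprime (Suc n) d"
    using assms by (metis cong_dvd_modulus_nat cong_imp_coprime cong_sym)
  then have "[?factor (Suc (m + n)) = ?factor (Suc n)] (mod m)"
    using shift by simp
  then have "[?factor (Suc (m + n)) * gauss_fact d (m + n) =
      ?factor (Suc n) * (gauss_fact d m * gauss_fact d n)] (mod m)"
    using Suc.IH by (rule cong_mult)
  then show ?case
    by (simp only: gauss_fact_Suc add_Suc_right mult.left_commute)
qed

lemma gauss_fact_cong_mod:
  assumes "d dvd m"
  shows "[gauss_fact d n = gauss_fact d m ^ (n div m) * gauss_fact d (n mod m)] (mod m)"
proof -
  have "[gauss_fact d (m * q + r) = gauss_fact d m ^ q * gauss_fact d r] (mod m)" for q r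
  proof (induction q)
    case 0
    then show ?case by simp
  next
    case (Suc q)
    have "[gauss_fact d (m + (m * q + r)) = gauss_fact d m * gauss_fact d (m * q + r)] (mod m)"
      using assms by (rule gauss_fact_add_cong)
    also have "[gauss_fact d m * gauss_fact d (m * q + r) =
        gauss_fact d m * (gauss_fact d m ^ q * gauss_fact d r)] (mod m)"
      using Suc.IH by (rule cong_scalar_left)
    finally show ?case
      by (simp add: mult.assoc add.assoc)
  qed
  from this[of "n div m" "n mod m"] show ?thesis
    by simp
qed

lemma gauss_fact_2_cong_8:
  "[int (gauss_fact 2 n) =
    3 ^ of_bool (n mod 8 \<in> {3, 4}) * (- 1) ^ of_bool (n mod 8 \<in> {5, 6})] (mod 8)"
proof -
  have block: "[gauss_fact 2 8 = 1] (mod 8)"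
    by (simp add: cong_def)
  have "[gauss_fact 2 n = gauss_fact 2 8 ^ (n div 8) * gauss_fact 2 (n mod 8)] (mod 8)"
    by (rule gauss_fact_cong_mod) simp
  also have "[gauss_fact 2 8 ^ (n div 8) * gauss_fact 2 (n mod 8) =
      1 ^ (n div 8) * gauss_fact 2 (n mod 8)] (mod 8)"
    by (intro cong_mult cong_pow block cong_refl)
  finally have "[gauss_fact 2 n = gauss_fact 2 (n mod 8)] (mod 8)"
    by (simp only: power_one mult_1_left)
  then have "[int (gauss_fact 2 n) = int (gauss_fact 2 (n mod 8))] (mod 8)"
    using cong_int_iff[of _ _ 8] by simp
  moreover have "n mod 8 \<in> {0, 1, 2, 3, 4, 5, 6, 7}"
    by auto
  then have "[int (gauss_fact 2 (n mod 8)) =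
      3 ^ of_bool (n mod 8 \<in> {3, 4}) * (- 1) ^ of_bool (n mod 8 \<in> {5, 6})] (mod 8)"
    by (auto simp: cong_def)
  ultimately show ?thesis
    by (rule cong_trans)
qed

lemma fact_eq_power_mult_gauss_fact:
  assumes "prime p"
  shows "(fact n :: nat) = p ^ (n div p) * fact (n div p) * gauss_fact p n"
proof -
  have "p > 0"
    using assms by (rule prime_gt_0_nat)
  have multiples: "{k \<in> {1..n}. p dvd k} = (*) p ` {1..n div p}"
    using \<open>p > 0\<close> by (auto simp: less_eq_div_iff_mult_less_eq mult.commute Suc_le_eq elim!: dvdE)
  have nonmultiples: "{k \<in> {1..n}. \<not> p dvd k} = {k \<in> {1..n}. coprime k p}"
    using assms by (metis coprime_absorb_left coprime_commute not_prime_unit prime_imp_coprime)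
  have "(fact n :: nat) = \<Prod>{k \<in> {1..n}. p dvd k} * \<Prod>{k \<in> {1..n}. \<not> p dvd k}"
    unfolding fact_prod by (subst prod.union_disjoint[symmetric]) (auto intro!: prod.cong)
  also have "\<Prod>{k \<in> {1..n}. p dvd k} = (\<Prod>k = 1..n div p. p * k)"
    unfolding multiples using \<open>p > 0\<close> by (subst prod.reindex) (auto simp: inj_on_def)
  also have "\<dots> = p ^ (n div p) * fact (n div p)"
    by (simp add: prod.distrib fact_prod)
  finally show ?thesis
    by (simp only: nonmultiples gauss_fact_def)
qed

lemma fact_eq_power_mult_prod_gauss_fact:
  assumes "prime p"
  shows "(fact n :: nat) =
    p ^ (\<Sum>k<N. n div p ^ Suc k) * (\<Prod>k<N. gauss_fact p (n div p ^ k)) * fact (n div p ^ N)"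
proof (induction N)
  case 0
  then show ?case by simp
next
  case (Suc N)
  have "n div p ^ N div p = n div p ^ Suc N"
    by (simp only: power_Suc2 div_mult2_eq)
  with fact_eq_power_mult_gauss_fact[OF assms, of "n div p ^ N"]
  have "(fact (n div p ^ N) :: nat) =
      p ^ (n div p ^ Suc N) * fact (n div p ^ Suc N) * gauss_fact p (n div p ^ N)"
    by simp
  with Suc.IH show ?case
    by (simp add: power_add mult_ac)
qed

lemma fact_eq_power_multiplicity_mult_prod_gauss_fact:
  assumes "prime p" "n < p ^ N"
  shows "(fact n :: nat) =
    p ^ multiplicity p (fact n :: nat) * (\<Prod>k<N. gauss_fact p (n div p ^ k))"
proof -
  let ?Z = "\<Prod>k<N. gauss_fact p (n div p ^ k)"
  have fact_n: "(fact n :: nat) = p ^ (\<Sum>k<N. n div p ^ Suc k) * ?Z"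
    using fact_eq_power_mult_prod_gauss_fact[OF assms(1), of n N] assms(2) by simp
  have "\<not> p dvd ?Z"
    using assms(1) by (metis coprime_absorb_right coprime_prod_gauss_fact not_prime_unit)
  with fact_n have "multiplicity p (fact n :: nat) = (\<Sum>k<N. n div p ^ Suc k)"
    using assms(1) by (intro multiplicity_decomposeI) auto
  with fact_n show ?thesis
    by simp
qed

lemma is_binary_rep_digit:
  assumes "is_binary_rep a n"
  shows "a k = n div 2 ^ k mod 2"
proof -
  have digit: "a j = of_bool (a j = 1)" for j
    using assms by (auto simp: is_binary_rep_def)
  obtain N where support: "{j. a j \<noteq> 0} \<subseteq> {..<N}"
    using assms finite_nat_iff_bounded unfolding is_binary_rep_def by blast
  have "n = (\<Sum>j<N. a j * 2 ^ j)"
    using assms support unfolding is_binary_rep_def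
    by (auto intro: sum.mono_neutral_left)
  also have "\<dots> = horner_sum of_bool 2 (map (\<lambda>j. a j = 1) [0..<N])"
    using digit by (auto simp: horner_sum_eq_sum atLeast0LessThan intro!: sum.cong)
  finally have "bit n k \<longleftrightarrow> k < N \<and> a k = 1"
    by (auto simp: bit_horner_sum_bit_iff)
  also have "\<dots> \<longleftrightarrow> a k = 1"
    using support by force
  finally show ?thesis
    using digit[of k] by (simp add: bit_iff_odd mod_2_eq_odd)
qed

lemma window3_eq_div_mod:
  assumes "is_binary_rep a n"
  shows "window3 a k = n div 2 ^ k mod 8"
proof -
  define q where "q = n div 2 ^ k"
  have "{k..k + 2} = {k, k + 1, k + 2}"
    by auto
  then have "window3 a k = a k + 2 * a (k + 1) + 4 * a (k + 2)"
    by (simp add: window3_def)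
  also have "\<dots> = q mod 2 + 2 * (q div 2 mod 2) + 4 * (q div 4 mod 2)"
    by (simp only: is_binary_rep_digit[OF assms] power_add div_mult2_eq q_def) simp
  also have "\<dots> = q mod 8"
    using mod_mult2_eq[of q 2 4] mod_mult2_eq[of "q div 2" 2 2]
    by (simp flip: div_mult2_eq)
  finally show ?thesis
    by (simp only: q_def)
qed

lemma card_window3_eq_sum:
  assumes "is_binary_rep a n" "0 \<notin> S" "n < 2 ^ N"
  shows "card {k. window3 a k \<in> S} = (\<Sum>k<N. of_bool (n div 2 ^ k mod 8 \<in> S))"
proof -
  have "n div 2 ^ k mod 8 \<notin> S" if "k \<ge> N" for k
  proof -
    have "n < 2 ^ k"
      using assms(3) that by (meson less_le_trans one_le_numeral power_increasing)
    then show ?thesis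
      using assms(2) by simp
  qed
  then have "{k. n div 2 ^ k mod 8 \<in> S} \<subseteq> {..<N}"
    using leI by blast
  then show ?thesis
    by (simp add: window3_eq_div_mod[OF assms(1)] inf.absorb2)
qed

lemma prod_gauss_fact_2_cong_8:
  assumes "is_binary_rep a n" "n < 2 ^ N"
  shows "[int (\<Prod>k<N. gauss_fact 2 (n div 2 ^ k)) = 3 ^ alpha3 a * (- 1) ^ alpha5 a] (mod 8)"
proof -
  let ?e = "\<lambda>S k. of_bool (n div 2 ^ k mod 8 \<in> S) :: nat"
  have "[int (\<Prod>k<N. gauss_fact 2 (n div 2 ^ k)) =
      (\<Prod>k<N. 3 ^ ?e {3, 4} k * (- 1) ^ ?e {5, 6} k)] (mod 8)"
    unfolding of_nat_prod by (intro cong_prod gauss_fact_2_cong_8)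
  also have "(\<Prod>k<N. 3 ^ ?e {3, 4} k * (- 1) ^ ?e {5, 6} k) =
      (3 ^ (\<Sum>k<N. ?e {3, 4} k) * (- 1) ^ (\<Sum>k<N. ?e {5, 6} k) :: int)"
    by (simp only: prod.distrib power_sum)
  also have "\<dots> = 3 ^ alpha3 a * (- 1) ^ alpha5 a"
    using assms card_window3_eq_sum[of a n "{3, 4}" N] card_window3_eq_sum[of a n "{5, 6}" N]
    by (simp only: alpha3_def alpha5_def) simp
  finally show ?thesis .
qed

theorem theorem8:
  fixes n \<gamma> :: nat and a :: "nat \<Rightarrow> nat"
  assumes "n > 0"
    and "is_binary_rep a n"
    and "\<gamma> = multiplicity 2 (fact n :: nat)"
  shows "\<exists>Z :: nat. fact n = 2 ^ \<gamma> * Z \<and> odd Z \<and>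
           [int Z = 3 ^ alpha3 a * (- 1) ^ alpha5 a] (mod 8)"
proof (intro exI conjI)
  let ?Z = "\<Prod>k<n. gauss_fact 2 (n div 2 ^ k)"
  show "fact n = 2 ^ \<gamma> * ?Z"
    unfolding assms(3)
    by (rule fact_eq_power_multiplicity_mult_prod_gauss_fact) (rule two_is_prime_nat, rule less_exp)
  show "odd ?Z"
    using coprime_prod_gauss_fact by (rule coprime_right_2_iff_odd[THEN iffD1])
  show "[int ?Z = 3 ^ alpha3 a * (- 1) ^ alpha5 a] (mod 8)"
    using assms(2) less_exp by (rule prod_gauss_fact_2_cong_8)
qed

end
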